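(* (Causal consistency.) Let $\omega_1$ and $\omega_2$ be two computations of RMPC. Then $\omega_1 \asymp \omega_2$ if and only if $\omega_1$ and $\omega_2$ are both coinitial and cofinal.
   Context: RMPC. Fix a countable set $\mathcal{A}$ of actions, rates in $\mathbb{R}_{>0}$, and a countable set $\mathcal{K}$ of keys. Forward processes: $P,Q ::= \mathbf{0} \mid \langle a,\lambda\rangle.P \mid P+Q \mid P\parallel_L Q$ ($L\subseteq\mathcal A$); reversible processes: $R,S ::= P \mid \langle a,\lambda\rangle[i].R \mid R+S \mid R\parallel_L S$ ($i\in\mathcal K$). $\mathrm{std}(R)$ means $R$ is a forward process; $\mathrm{key}(R)$ is the set of keys occurring in $R$. Every rate $\lambda$ has an associated backward rate $\overline{\lambda}>0$. Forward $\to$ and backward $\rightsquigarrow$ transition relations are the least relations closed under (symmetric variants of Cho, Par, Cho$^r$, Par$^r$ included): (Act1) if $\mathrm{std}(R)$ then $\langle a,\lambda\rangle.R \xrightarrow{\langle a,\lambda\rangle[i]} \langle a,\lambda\rangle[i].R$ for every $i\in\mathcal K$; (Act1$^r$) if $\mathrm{std}(R)$ then $\langle a,\lambda\rangle[i].R \rightsquigarrow^{\langle a,\overline\lambda\rangle[i]} \langle a,\lambda\rangle.R$. (Act2) if $R\xrightarrow{\langle b,\mu\rangle[j]}R'$ and $j\neq i$ then $\langle a,\lambda\rangle[i].R\xrightarrow{\langle b,\mu\rangle[j]}\langle a,\lambda\rangle[i].R'$; (Act2$^r$) the same with $\rightsquigarrow$ and label $\langle b,\overline\mu\rangle[j]$.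 (Cho) if $R\xrightarrow{\ell}R'$ and $\mathrm{std}(S)$ then $R+S\xrightarrow{\ell}R'+S$; (Cho$^r$) the same with $\rightsquigarrow$. (Par) if $R\xrightarrow{\langle a,\lambda\rangle[i]}R'$, $a\notin L$, $i\notin\mathrm{key}(S)$ then $R\parallel_L S\xrightarrow{\langle a,\lambda\rangle[i]}R'\parallel_L S$; (Par$^r$) the same with $\rightsquigarrow$. (Coo) if $R\xrightarrow{\langle a,\lambda\rangle[i]}R'$, $S\xrightarrow{\langle a,\mu\rangle[i]}S'$, $a\in L$ then $R\parallel_L S\xrightarrow{\langle a,\lambda\cdot\mu\rangle[i]}R'\parallel_L S'$; (Coo$^r$) if $R\rightsquigarrow^{\langle a,\overline\lambda\rangle[i]}R'$, $S\rightsquigarrow^{\langle a,\overline\mu\rangle[i]}S'$, $a\in L$ then $R\parallel_L S\rightsquigarrow^{\langle a,\overline\lambda\cdot\overline\mu\rangle[i]}R'\parallel_L S'$. $\mathcal P$ (reachable processes) = forward processes plus all processes obtained from them by finitely many forward transitions. A transition $R\mapsto^\ell S$ is an element of $\to\cup\rightsquigarrow$ with $R,S\in\mathcal P$; $R$ is its source, $S$ its target; coinitial = same source, cofinal = same target, composable = target of the first is source of the second. A computation is a finite sequence of pairwise composable transitions ($\epsilon$ the empty computation; source/target/coinitiality/cofinality extend to computations). For a forward transition $\theta=R\xrightarrow{\langle a,\lambda\rangle[i]}S$, $\overline\theta = S\rightsquigarrow^{\langle a,\overline\lambda\rangle[i]}R$ (a synchronization rate $\lambda\cdot\mu$ corresponds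 to $\overline\lambda\cdot\overline\mu$), and symmetrically the reverse of a backward transition is the corresponding forward transition. Causal set: $\mathrm{cau}(P,i)=\emptyset$; $\mathrm{cau}(\langle a,\lambda\rangle[j].R,i)=\emptyset$ if $j=i$ or $i\notin\mathrm{key}(R)$, and $\{j\}\cup\mathrm{cau}(R,i)$ otherwise; $\mathrm{cau}(R+S,i)=\mathrm{cau}(R\parallel_L S,i)=\mathrm{cau}(R,i)\cup\mathrm{cau}(S,i)$. Process contexts: $\mathcal C ::= \bullet \mid \langle a,\lambda\rangle[i].\mathcal C \mid R+\mathcal C \mid \mathcal C+R \mid R\parallel_L\mathcal C \mid \mathcal C\parallel_L R$. Two coinitial transitions $\theta_1,\theta_2$ from $R$ are in conflict iff (1) $\theta_1 = R\xrightarrow{\langle a,\lambda\rangle[i]}S_1$, $\theta_2 = R\rightsquigarrow^{\langle b,\overline\mu\rangle[j]}S_2$ with $j\in\mathrm{cau}(S_1,i)$, or (2) $R=\mathcal C[P_1+P_2]$ and each $\theta_k$ ($k=1,2$) is derived from a forward transition $P_k\xrightarrow{\langle a_k,\lambda_k\rangle[i_k]}S_k$; they are concurrent iff not in conflict. Causal equivalence $\asymp$ is the smallest equivalence relation on computations closed under composition such that (1) $\theta_1\theta'_2\asymp\theta_2\theta'_1$ for any coinitial concurrent $\theta_1=R\mapsto^{\ell_1}R_1$, $\theta_2=R\mapsto^{\ell_2}R_2$ and cofinal $\theta'_2=R_1\mapsto^{\ell_2}S$, $\theta'_1=R_2\mapsto^{\ell_1}S$; (2) $\theta\overline\theta\asymp\epsilon$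 and $\overline\theta\theta\asymp\epsilon$. *)

theory Defs
  imports Complex_Main "HOL-Library.Countable"
begin

typedef rate = "{x :: real. 0 < x}"
  by (rule exI[of _ 1]) simp

setup_lifting type_definition_rate

instantiation rate :: times
begin
lift_definition times_rate :: "rate \<Rightarrow> rate \<Rightarrow> rate" is "(*)"
  by (rule mult_pos_pos)
instance ..
end

text \<open>
  One datatype covers both syntactic categories: the forward processes are the terms satisfying
  \<open>std\<close> below.  The datatype also contains terms \<open>Pre a l R\<close> with \<open>R\<close> not forward, which the
  grammar of reversible processes excludes; such a term has no transition and is not \<open>reachable\<close>.
\<close>

datatype ('a, 'k) proc =
    Null
  | Pre 'a rate "('a, 'k) proc"
  | Past 'a rate 'k "('a, 'k) proc"
  | Sum "('a, 'k) proc" "('a, 'k) proc"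
  | Par "('a, 'k) proc" "'a set" "('a, 'k) proc"

fun std :: "('a, 'k) proc \<Rightarrow> bool" where
  "std Null \<longleftrightarrow> True"
| "std (Pre a l R) \<longleftrightarrow> std R"
| "std (Past a l i R) \<longleftrightarrow> False"
| "std (Sum R S) \<longleftrightarrow> std R \<and> std S"
| "std (Par R L S) \<longleftrightarrow> std R \<and> std S"

fun keys :: "('a, 'k) proc \<Rightarrow> 'k set" where
  "keys Null = {}"
| "keys (Pre a l R) = keys R"
| "keys (Past a l i R) = insert i (keys R)"
| "keys (Sum R S) = keys R \<union> keys S"
| "keys (Par R L S) = keys R \<union> keys S"

text \<open>\<open>(a, l, i)\<close> stands for the label \<open>\<langle>a, l\<rangle>[i]\<close>.\<close>

type_synonym ('a, 'k) label = "'a \<times> rate \<times> 'k"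

inductive fwd :: "('a, 'k) proc \<Rightarrow> ('a, 'k) label \<Rightarrow> ('a, 'k) proc \<Rightarrow> bool" where
  Act1: "std R \<Longrightarrow> fwd (Pre a l R) (a, l, i) (Past a l i R)"
| Act2: "fwd R (b, m, j) R' \<Longrightarrow> j \<noteq> i \<Longrightarrow> fwd (Past a l i R) (b, m, j) (Past a l i R')"
| ChoL: "fwd R x R' \<Longrightarrow> std S \<Longrightarrow> fwd (Sum R S) x (Sum R' S)"
| ChoR: "fwd S x S' \<Longrightarrow> std R \<Longrightarrow> fwd (Sum R S) x (Sum R S')"
| ParL: "fwd R (a, l, i) R' \<Longrightarrow> a \<notin> L \<Longrightarrow> i \<notin> keys S \<Longrightarrow>
         fwd (Par R L S) (a, l, i) (Par R' L S)"
| ParR: "fwd S (a, l, i) S' \<Longrightarrow> a \<notin> L \<Longrightarrow> i \<notin> keys R \<Longrightarrow>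
         fwd (Par R L S) (a, l, i) (Par R L S')"
| Coo:  "fwd R (a, l, i) R' \<Longrightarrow> fwd S (a, m, i) S' \<Longrightarrow> a \<in> L \<Longrightarrow>
         fwd (Par R L S) (a, l * m, i) (Par R' L S')"

text \<open>
  \<open>bar\<close> assigns to each rate its backward rate.  It is not assumed to be multiplicative: the rate
  of a backward synchronization is the product of the two backward rates.
\<close>

inductive bwd :: "(rate \<Rightarrow> rate) \<Rightarrow> ('a, 'k) proc \<Rightarrow> ('a, 'k) label \<Rightarrow> ('a, 'k) proc \<Rightarrow> bool"
  for bar where
  Act1r: "std R \<Longrightarrow> bwd bar (Past a l i R) (a, bar l, i) (Pre a l R)"
| Act2r: "bwd bar R (b, m, j) R' \<Longrightarrow> j \<noteq> i \<Longrightarrow> bwd bar (Past a l i R) (b, m, j) (Past a l i R')"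
| ChoLr: "bwd bar R x R' \<Longrightarrow> std S \<Longrightarrow> bwd bar (Sum R S) x (Sum R' S)"
| ChoRr: "bwd bar S x S' \<Longrightarrow> std R \<Longrightarrow> bwd bar (Sum R S) x (Sum R S')"
| ParLr: "bwd bar R (a, l, i) R' \<Longrightarrow> a \<notin> L \<Longrightarrow> i \<notin> keys S \<Longrightarrow>
          bwd bar (Par R L S) (a, l, i) (Par R' L S)"
| ParRr: "bwd bar S (a, l, i) S' \<Longrightarrow> a \<notin> L \<Longrightarrow> i \<notin> keys R \<Longrightarrow>
          bwd bar (Par R L S) (a, l, i) (Par R L S')"
| Coor:  "bwd bar R (a, l, i) R' \<Longrightarrow> bwd bar S (a, m, i) S' \<Longrightarrow> a \<in> L \<Longrightarrow>
          bwd bar (Par R L S) (a, l * m, i) (Par R' L S')"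

definition reachable :: "('a, 'k) proc \<Rightarrow> bool" where
  "reachable R \<longleftrightarrow> (\<exists>P. std P \<and> (\<lambda>S S'. \<exists>x. fwd S x S')\<^sup>*\<^sup>* P R)"

datatype dir = Forward | Backward

datatype ('a, 'k) trans =
  Trans (src: "('a, 'k) proc") (dir: dir) (lab: "('a, 'k) label") (tgt: "('a, 'k) proc")

abbreviation act_of :: "('a, 'k) trans \<Rightarrow> 'a" where "act_of t \<equiv> fst (lab t)"
abbreviation rate_of :: "('a, 'k) trans \<Rightarrow> rate" where "rate_of t \<equiv> fst (snd (lab t))"
abbreviation key_of :: "('a, 'k) trans \<Rightarrow> 'k" where "key_of t \<equiv> snd (snd (lab t))"

definition is_trans :: "(rate \<Rightarrow> rate) \<Rightarrow> ('a, 'k) trans \<Rightarrow> bool" where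
  "is_trans bar t \<longleftrightarrow> reachable (src t) \<and> reachable (tgt t) \<and>
     (case dir t of
        Forward \<Rightarrow> fwd (src t) (lab t) (tgt t)
      | Backward \<Rightarrow> bwd bar (src t) (lab t) (tgt t))"

text \<open>
  \<open>corr_rate bar l m\<close>: \<open>m\<close> is a backward rate corresponding to \<open>l\<close>, where \<open>l\<close> is read either as a
  basic rate or as a (nested) synchronization rate.
\<close>

inductive corr_rate :: "(rate \<Rightarrow> rate) \<Rightarrow> rate \<Rightarrow> rate \<Rightarrow> bool" for bar where
  basic: "corr_rate bar l (bar l)"
| synch: "corr_rate bar l l' \<Longrightarrow> corr_rate bar m m' \<Longrightarrow> corr_rate bar (l * m) (l' * m')"

text \<open>
  The same number can be a rate in several of these ways, so \<open>corr_rate\<close> is only a relation.  Among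
  transitions this leaves no freedom: source, target, action and key of a transition determine its
  derivation, hence its rate, so each transition has exactly one reverse.
\<close>

definition fwd_bwd_pair :: "(rate \<Rightarrow> rate) \<Rightarrow> ('a, 'k) trans \<Rightarrow> ('a, 'k) trans \<Rightarrow> bool" where
  "fwd_bwd_pair bar t u \<longleftrightarrow> dir t = Forward \<and> dir u = Backward \<and>
     src u = tgt t \<and> tgt u = src t \<and> act_of u = act_of t \<and> key_of u = key_of t \<and>
     corr_rate bar (rate_of t) (rate_of u)"

definition is_reverse :: "(rate \<Rightarrow> rate) \<Rightarrow> ('a, 'k) trans \<Rightarrow> ('a, 'k) trans \<Rightarrow> bool" where
  "is_reverse bar t u \<longleftrightarrow> fwd_bwd_pair bar t u \<or> fwd_bwd_pair bar u t"

text \<open>The clause for \<open>Pre\<close> is the case of a forward process, whose causal sets are empty.\<close>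

fun cau :: "('a, 'k) proc \<Rightarrow> 'k \<Rightarrow> 'k set" where
  "cau Null i = {}"
| "cau (Pre a l R) i = {}"
| "cau (Past a l j R) i = (if j = i \<or> i \<notin> keys R then {} else {j} \<union> cau R i)"
| "cau (Sum R S) i = cau R i \<union> cau S i"
| "cau (Par R L S) i = cau R i \<union> cau S i"

datatype ('a, 'k) ctxt =
    Hole
  | CPast 'a rate 'k "('a, 'k) ctxt"
  | CSumR "('a, 'k) proc" "('a, 'k) ctxt"
  | CSumL "('a, 'k) ctxt" "('a, 'k) proc"
  | CParR "('a, 'k) proc" "'a set" "('a, 'k) ctxt"
  | CParL "('a, 'k) ctxt" "'a set" "('a, 'k) proc"

fun plug :: "('a, 'k) ctxt \<Rightarrow> ('a, 'k) proc \<Rightarrow> ('a, 'k) proc" where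
  "plug Hole X = X"
| "plug (CPast a l i C) X = Past a l i (plug C X)"
| "plug (CSumR R C) X = Sum R (plug C X)"
| "plug (CSumL C R) X = Sum (plug C X) R"
| "plug (CParR R L C) X = Par R L (plug C X)"
| "plug (CParL C L R) X = Par (plug C X) L R"

text \<open>
  \<open>derived_from X x X' C y Y\<close>: the forward transition from \<open>plug C X\<close> to \<open>Y\<close> with label \<open>y\<close> has a
  derivation in which the subterm \<open>X\<close> at the hole performs \<open>fwd X x X'\<close>.  The labels \<open>x\<close> and \<open>y\<close>
  may differ in the rate, because of synchronizations with components of \<open>C\<close>.
\<close>

inductive derived_from :: "('a, 'k) proc \<Rightarrow> ('a, 'k) label \<Rightarrow> ('a, 'k) proc \<Rightarrow>
    ('a, 'k) ctxt \<Rightarrow> ('a, 'k) label \<Rightarrow> ('a, 'k) proc \<Rightarrow> bool"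
  for X x X' where
  "fwd X x X' \<Longrightarrow> derived_from X x X' Hole x X'"
| "derived_from X x X' C (b, m, j) Y \<Longrightarrow> j \<noteq> i \<Longrightarrow>
   derived_from X x X' (CPast a l i C) (b, m, j) (Past a l i Y)"
| "derived_from X x X' C y Y \<Longrightarrow> std R \<Longrightarrow> derived_from X x X' (CSumR R C) y (Sum R Y)"
| "derived_from X x X' C y Y \<Longrightarrow> std R \<Longrightarrow> derived_from X x X' (CSumL C R) y (Sum Y R)"
| "derived_from X x X' C (a, l, i) Y \<Longrightarrow> a \<notin> L \<Longrightarrow> i \<notin> keys R \<Longrightarrow>
   derived_from X x X' (CParR R L C) (a, l, i) (Par R L Y)"
| "derived_from X x X' C (a, l, i) Y \<Longrightarrow> a \<notin> L \<Longrightarrow> i \<notin> keys R \<Longrightarrow>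
   derived_from X x X' (CParL C L R) (a, l, i) (Par Y L R)"
| "fwd R (a, l, i) R' \<Longrightarrow> derived_from X x X' C (a, m, i) Y \<Longrightarrow> a \<in> L \<Longrightarrow>
   derived_from X x X' (CParR R L C) (a, l * m, i) (Par R' L Y)"
| "derived_from X x X' C (a, l, i) Y \<Longrightarrow> fwd R (a, m, i) R' \<Longrightarrow> a \<in> L \<Longrightarrow>
   derived_from X x X' (CParL C L R) (a, l * m, i) (Par Y L R')"

definition causal_conflict :: "('a, 'k) trans \<Rightarrow> ('a, 'k) trans \<Rightarrow> bool" where
  "causal_conflict t u \<longleftrightarrow> dir t = Forward \<and> dir u = Backward \<and> key_of u \<in> cau (tgt t) (key_of t)"

definition choice_conflict :: "('a, 'k) trans \<Rightarrow> ('a, 'k) trans \<Rightarrow> bool" where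
  "choice_conflict t u \<longleftrightarrow> dir t = Forward \<and> dir u = Forward \<and>
     (\<exists>C P1 P2 x1 x2 S1 S2. std P1 \<and> std P2 \<and> src t = plug C (Sum P1 P2) \<and>
        fwd P1 x1 S1 \<and> derived_from (Sum P1 P2) x1 (Sum S1 P2) C (lab t) (tgt t) \<and>
        fwd P2 x2 S2 \<and> derived_from (Sum P1 P2) x2 (Sum P1 S2) C (lab u) (tgt u))"

text \<open>Conflict is a property of the unordered pair of transitions.\<close>

definition conflict :: "('a, 'k) trans \<Rightarrow> ('a, 'k) trans \<Rightarrow> bool" where
  "conflict t u \<longleftrightarrow> src t = src u \<and>
     (causal_conflict t u \<or> causal_conflict u t \<or> choice_conflict t u \<or> choice_conflict u t)"

definition concurrent :: "('a, 'k) trans \<Rightarrow> ('a, 'k) trans \<Rightarrow> bool" where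
  "concurrent t u \<longleftrightarrow> src t = src u \<and> \<not> conflict t u"

text \<open>
  A computation carries its source, so that there is one empty computation for each reachable
  process and every computation has a source and a target.
\<close>

datatype ('a, 'k) comp = Comp (csrc: "('a, 'k) proc") (steps: "('a, 'k) trans list")

fun ctgt :: "('a, 'k) comp \<Rightarrow> ('a, 'k) proc" where
  "ctgt (Comp R ts) = (if ts = [] then R else tgt (last ts))"

fun path :: "(rate \<Rightarrow> rate) \<Rightarrow> ('a, 'k) proc \<Rightarrow> ('a, 'k) trans list \<Rightarrow> bool" where
  "path bar R [] \<longleftrightarrow> True"
| "path bar R (t # ts) \<longleftrightarrow> is_trans bar t \<and> src t = R \<and> path bar (tgt t) ts"

definition is_comp :: "(rate \<Rightarrow> rate) \<Rightarrow> ('a, 'k) comp \<Rightarrow> bool" where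
  "is_comp bar w \<longleftrightarrow> reachable (csrc w) \<and> path bar (csrc w) (steps w)"

definition ccat :: "('a, 'k) comp \<Rightarrow> ('a, 'k) comp \<Rightarrow> ('a, 'k) comp" where
  "ccat v w = Comp (csrc v) (steps v @ steps w)"

definition coinitial_comps :: "('a, 'k) comp \<Rightarrow> ('a, 'k) comp \<Rightarrow> bool" where
  "coinitial_comps v w \<longleftrightarrow> csrc v = csrc w"

definition cofinal_comps :: "('a, 'k) comp \<Rightarrow> ('a, 'k) comp \<Rightarrow> bool" where
  "cofinal_comps v w \<longleftrightarrow> ctgt v = ctgt w"

text \<open>
  In \<open>swap\<close>, \<open>t'\<close> and \<open>u'\<close> have not only the labels but also the directions of \<open>t\<close> and \<open>u\<close>.
\<close>

inductive causal_eq :: "(rate \<Rightarrow> rate) \<Rightarrow> ('a, 'k) comp \<Rightarrow> ('a, 'k) comp \<Rightarrow> bool" for bar where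
  refl: "is_comp bar w \<Longrightarrow> causal_eq bar w w"
| sym: "causal_eq bar v w \<Longrightarrow> causal_eq bar w v"
| trans: "causal_eq bar u v \<Longrightarrow> causal_eq bar v w \<Longrightarrow> causal_eq bar u w"
| cat: "causal_eq bar v w \<Longrightarrow> causal_eq bar v' w' \<Longrightarrow> ctgt v = csrc v' \<Longrightarrow> ctgt w = csrc w' \<Longrightarrow>
    causal_eq bar (ccat v v') (ccat w w')"
| swap: "is_trans bar t \<Longrightarrow> is_trans bar u \<Longrightarrow> is_trans bar t' \<Longrightarrow> is_trans bar u' \<Longrightarrow>
    concurrent t u \<Longrightarrow>
    src u' = tgt t \<Longrightarrow> dir u' = dir u \<Longrightarrow> lab u' = lab u \<Longrightarrow>
    src t' = tgt u \<Longrightarrow> dir t' = dir t \<Longrightarrow> lab t' = lab t \<Longrightarrow>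
    tgt u' = tgt t' \<Longrightarrow>
    causal_eq bar (Comp (src t) [t, u']) (Comp (src u) [u, t'])"
| cancel: "is_trans bar t \<Longrightarrow> is_trans bar u \<Longrightarrow> is_reverse bar t u \<Longrightarrow>
    causal_eq bar (Comp (src t) [t, u]) (Comp (src t) [])"

end

theory Submission
  imports Defs
begin

text \<open>
  A backward transition is determined by its source and key, and backward transitions with the same
  source are always concurrent and complete to a square; moreover they consume a key.  Hence, as in
  Newman's lemma, all backward computations from \<open>R\<close> to a forward process are causally equivalent.
  A transition from \<open>R\<close> to \<open>R'\<close> is therefore equivalent to the backward computation from \<open>R\<close> to the
  origin followed by the reverse of the one from \<open>R'\<close>, and so is every computation from \<open>R\<close> to \<open>R'\<close>.
\<close>

section \<open>Transitions\<close>

lemma finite_keys: "finite (keys R)"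
  by (induction R) auto

lemma std_keys: "std R \<longleftrightarrow> keys R = {}"
  by (induction R) auto

text \<open>\<open>Act1r\<close> needs a key-free continuation, the choice rules a key-free other
  summand, and the side conditions of \<open>Act2r\<close>, \<open>ParLr\<close> and
  \<open>ParRr\<close> keep the undone key from occurring elsewhere. In \<open>Coor\<close> both
  components lose it.\<close>

lemma bwd_keys:
  assumes "bwd bar R x R'"
  shows "keys R = insert (snd (snd x)) (keys R') \<and> snd (snd x) \<notin> keys R'"
  using assms by induction (auto simp: std_keys)

lemma bwd_card_keys: "bwd bar R x R' \<Longrightarrow> card (keys R') < card (keys R)"
  using bwd_keys[of bar R x R'] by (simp add: finite_keys)

lemma std_no_bwd: "std R \<Longrightarrow> \<not> bwd bar R x R'"
  using bwd_keys[of bar R x R'] by (auto simp: std_keys)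

text \<open>Each forward rule has a backward mirror image with the same side conditions. The rate
  \<open>m\<close> is assembled along the derivation, since \<open>bar\<close> need not be
  multiplicative.\<close>

lemma fwd_imp_bwd:
  assumes "fwd R x R'"
  shows "\<exists>m. bwd bar R' (fst x, m, snd (snd x)) R \<and> corr_rate bar (fst (snd x)) m"
  using assms by induction (simp?, blast intro: bwd.intros corr_rate.intros)+

text \<open>The forward rate comes from the executed prefixes in the derivation, not from the
  backward label: \<open>bar\<close> may fail to be injective.\<close>

lemma bwd_imp_fwd:
  assumes "bwd bar R x R'"
  shows "\<exists>m. fwd R' (fst x, m, snd (snd x)) R \<and> corr_rate bar m (fst (snd x))"
  using assms by induction (simp?, blast intro: fwd.intros corr_rate.intros)+

section \<open>Determinism and the diamond property of backward transitions\<close>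

inductive_cases bwd_PastE [consumes 1, case_names here below]: "bwd bar (Past a l i R) x R'"
inductive_cases bwd_SumE [consumes 1, case_names left right]: "bwd bar (Sum R S) x R'"
inductive_cases bwd_ParE [consumes 1, case_names left right both]: "bwd bar (Par R L S) x R'"

text \<open>The key decides which rule applies. A past prefix is undone only over a
  \<open>std\<close> continuation, which has no backward transition; in a sum only the
  non-\<open>std\<close> summand moves; in a parallel composition the key occurs on one side for a
  lone move and on both sides for a synchronization.\<close>

lemma bwd_determ:
  assumes "bwd bar R x R1" and "bwd bar R y R2" and "snd (snd x) = snd (snd y)"
  shows "x = y \<and> R1 = R2"
  using assms
proof (induction arbitrary: y R2)
  case (Act1r R a l i)
  from Act1r.prems(1) show ?case
    by (rule bwd_PastE) (use Act1r in \<open>auto simp: std_no_bwd\<close>)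
next
  case (Act2r R b m j R' i a l)
  from Act2r.prems(1) show ?case
    by (rule bwd_PastE) (use Act2r in \<open>auto simp: std_no_bwd\<close>)
next
  case (ChoLr R x R' S)
  from ChoLr.prems(1) show ?case
    by (rule bwd_SumE) (use ChoLr in \<open>auto simp: std_no_bwd\<close>)
next
  case (ChoRr S x S' R)
  from ChoRr.prems(1) show ?case
    by (rule bwd_SumE) (use ChoRr in \<open>auto simp: std_no_bwd\<close>)
next
  case (ParLr R a l i R' L S)
  from ParLr.prems(1) show ?case
  proof (cases rule: bwd_ParE)
    case (left b m j R'')
    then show ?thesis using ParLr.IH[of y R''] ParLr.prems by simp
  next
    case (right b m j S'')
    \<comment> \<open>Impossible: a move of \<open>S\<close> with key \<open>i\<close> needs
      \<open>i\<close> in \<open>keys S\<close>, against the side condition of \<open>ParLr\<close>.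
      The other mixed cases fail likewise.\<close>
    then show ?thesis using ParLr.hyps ParLr.prems bwd_keys[of bar S y S''] by auto
  next
    case (both b l' j R'' m S'')
    then show ?thesis using ParLr.hyps ParLr.prems bwd_keys[of bar S "(b, m, j)" S''] by auto
  qed
next
  case (ParRr S a l i S' L R)
  from ParRr.prems(1) show ?case
  proof (cases rule: bwd_ParE)
    case (left b m j R'')
    then show ?thesis using ParRr.hyps ParRr.prems bwd_keys[of bar R y R''] by auto
  next
    case (right b m j S'')
    then show ?thesis using ParRr.IH[of y S''] ParRr.prems by simp
  next
    case (both b l' j R'' m S'')
    then show ?thesis using ParRr.hyps ParRr.prems bwd_keys[of bar R "(b, l', j)" R''] by auto
  qed
next
  case (Coor R a l i R' S m S' L)
  from Coor.prems(1) show ?case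
  proof (cases rule: bwd_ParE)
    case (left b m' j R'')
    then show ?thesis using Coor.hyps Coor.prems bwd_keys[of bar S "(a, m, i)" S'] by auto
  next
    case (right b m' j S'')
    then show ?thesis using Coor.hyps Coor.prems bwd_keys[of bar R "(a, l, i)" R'] by auto
  next
    case (both b l' j R'' m' S'')
    then show ?thesis
      using Coor.IH(1)[of "(b, l', j)" R''] Coor.IH(2)[of "(b, m', j)" S''] Coor.prems by auto
  qed
qed

text \<open>Nested prefixes are undone from the inside out, so undo steps with distinct keys part
  ways only at a parallel composition, where they act on different sides. Key side conditions
  survive because undoing only removes keys.\<close>

lemma bwd_diamond:
  assumes "bwd bar R x R1" and "bwd bar R y R2" and "snd (snd x) \<noteq> snd (snd y)"
  shows "\<exists>S. bwd bar R1 y S \<and> bwd bar R2 x S"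
  using assms
proof (induction arbitrary: y R2)
  case (Act1r R a l i)
  from Act1r.prems(1) show ?case
    by (rule bwd_PastE) (use Act1r in \<open>auto simp: std_no_bwd\<close>)
next
  case (Act2r R b m j R' i a l)
  from Act2r.prems(1) show ?case
  proof (cases rule: bwd_PastE)
    case here
    then show ?thesis using Act2r.hyps std_no_bwd by blast
  next
    case (below c m' k R'')
    then obtain S where "bwd bar R' y S" "bwd bar R'' (b, m, j) S"
      using Act2r.IH[of y R''] Act2r.prems by auto
    then show ?thesis using below Act2r.hyps by (metis bwd.Act2r)
  qed
next
  case (ChoLr R x R' S)
  from ChoLr.prems(1) show ?case
  proof (cases rule: bwd_SumE)
    case (left R'')
    then show ?thesis using ChoLr.IH[of y R''] ChoLr.hyps ChoLr.prems by (metis bwd.ChoLr)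
  next
    case (right S')
    then show ?thesis using ChoLr.hyps std_no_bwd by blast
  qed
next
  case (ChoRr S x S' R)
  from ChoRr.prems(1) show ?case
  proof (cases rule: bwd_SumE)
    case (left R')
    then show ?thesis using ChoRr.hyps std_no_bwd by blast
  next
    case (right S'')
    then show ?thesis using ChoRr.IH[of y S''] ChoRr.hyps ChoRr.prems by (metis bwd.ChoRr)
  qed
next
  case (ParLr R a l i R' L S)
  from ParLr.prems(1) show ?case
  proof (cases rule: bwd_ParE)
    case (left b m j R'')
    then show ?thesis using ParLr by (metis bwd.ParLr snd_conv)
  next
    case (right b m j S'')
    then have "bwd bar (Par R' L S) y (Par R' L S'')" and "i \<notin> keys S''"
      using ParLr.hyps bwd_keys[of bar R "(a,l,i)" R'] bwd_keys[of bar S "(b,m,j)" S'']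
      by (auto intro: bwd.ParRr)
    then show ?thesis using right ParLr.hyps by (metis bwd.ParLr)
  next
    case (both b l' j R'' m S'')
    then obtain T where "bwd bar R' (b, l', j) T" "bwd bar R'' (a, l, i) T"
      using ParLr.IH[of "(b, l', j)" R''] ParLr.prems by auto
    \<comment> \<open>The lone undo with key \<open>i\<close> must still be allowed once the
      synchronization has turned \<open>S\<close> into \<open>S''\<close>.\<close>
    moreover have "i \<notin> keys S''"
      using both ParLr.hyps bwd_keys[of bar S "(b,m,j)" S''] by auto
    ultimately show ?thesis using both ParLr.hyps by (metis bwd.ParLr bwd.Coor)
  qed
next
  case (ParRr S a l i S' L R)
  from ParRr.prems(1) show ?case
  proof (cases rule: bwd_ParE)
    case (left b m j R'')
    then have "bwd bar (Par R L S') y (Par R'' L S')" and "i \<notin> keys R''"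
      using ParRr.hyps bwd_keys[of bar S "(a,l,i)" S'] bwd_keys[of bar R "(b,m,j)" R'']
      by (auto intro: bwd.ParLr)
    then show ?thesis using left ParRr.hyps by (metis bwd.ParRr)
  next
    case (right b m j S'')
    then show ?thesis using ParRr by (metis bwd.ParRr snd_conv)
  next
    case (both b l' j R'' m S'')
    then obtain T where "bwd bar S' (b, m, j) T" "bwd bar S'' (a, l, i) T"
      using ParRr.IH[of "(b, m, j)" S''] ParRr.prems by auto
    moreover have "i \<notin> keys R''"
      using both ParRr.hyps bwd_keys[of bar R "(b,l',j)" R''] by auto
    ultimately show ?thesis using both ParRr.hyps by (metis bwd.ParRr bwd.Coor)
  qed
next
  case (Coor R a l i R' S m S' L)
  from Coor.prems(1) show ?case
  proof (cases rule: bwd_ParE)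
    case (left b m' j R'')
    then obtain T where "bwd bar R' (b, m', j) T" "bwd bar R'' (a, l, i) T"
      using Coor.IH(1)[of "(b, m', j)" R''] Coor.prems by auto
    moreover have "j \<notin> keys S'"
      using left Coor.hyps bwd_keys[of bar S "(a,m,i)" S'] by auto
    ultimately show ?thesis using left Coor.hyps by (metis bwd.ParLr bwd.Coor)
  next
    case (right b m' j S'')
    then obtain T where "bwd bar S' (b, m', j) T" "bwd bar S'' (a, m, i) T"
      using Coor.IH(2)[of "(b, m', j)" S''] Coor.prems by auto
    moreover have "j \<notin> keys R'"
      using right Coor.hyps bwd_keys[of bar R "(a,l,i)" R'] by auto
    ultimately show ?thesis using right Coor.hyps by (metis bwd.ParRr bwd.Coor)
  next
    case (both b l' j R'' m' S'')
    \<comment> \<open>Two synchronizations with different keys: a square in each component, glued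
      corner by corner with \<open>Coor\<close>.\<close>
    obtain T where "bwd bar R' (b, l', j) T" "bwd bar R'' (a, l, i) T"
      using both Coor.IH(1)[of "(b, l', j)" R''] Coor.prems by auto
    moreover obtain U where "bwd bar S' (b, m', j) U" "bwd bar S'' (a, m, i) U"
      using both Coor.IH(2)[of "(b, m', j)" S''] Coor.prems by auto
    ultimately show ?thesis using both Coor.hyps by (metis bwd.Coor)
  qed
qed

section \<open>Reachable processes\<close>

lemma reachable_induct [consumes 1, case_names std step]:
  assumes "reachable R"
    and "\<And>P. std P \<Longrightarrow> Q P"
    and "\<And>R x R'. reachable R \<Longrightarrow> Q R \<Longrightarrow> fwd R x R' \<Longrightarrow> Q R'"
  shows "Q R"
proof -
  obtain P where P: "std P" "(\<lambda>S S'. \<exists>x. fwd S x S')\<^sup>*\<^sup>* P R"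
    using assms(1) by (auto simp: reachable_def)
  from P(2) show ?thesis
  proof induction
    case base
    then show ?case using P(1) assms(2) by blast
  next
    case (step S S')
    then show ?case using P(1) assms(3) unfolding reachable_def by blast
  qed
qed

lemma reachable_fwd: "reachable R \<Longrightarrow> fwd R x R' \<Longrightarrow> reachable R'"
  unfolding reachable_def by (blast intro: rtranclp.rtrancl_into_rtrancl)

text \<open>Reachability is defined by forward steps only. The undo step either reverses the last
  forward step or commutes with its reversal.\<close>

lemma reachable_bwd:
  assumes "reachable R" and "bwd bar R x R'"
  shows "reachable R'"
  using assms
proof (induction arbitrary: x R' rule: reachable_induct)
  case (std P)
  then show ?case by (simp add: std_no_bwd)
next
  case (step R0 y R)
  obtain m where m: "bwd bar R (fst y, m, snd (snd y)) R0"
    using fwd_imp_bwd step.hyps(2) by blast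
  show ?case
  proof (cases "snd (snd x) = snd (snd y)")
    case True
    then show ?thesis using bwd_determ[OF step.prems m] step.hyps(1) by simp
  next
    case False
    then obtain S where S: "bwd bar R' (fst y, m, snd (snd y)) S" "bwd bar R0 x S"
      using bwd_diamond[OF step.prems m] by auto
    \<comment> \<open>\<open>S\<close> is reachable by the induction hypothesis for
      \<open>R0\<close>, and redoing the last forward step leads from \<open>S\<close> to
      \<open>R'\<close>.\<close>
    then show ?thesis
      using step.IH reachable_fwd bwd_imp_fwd by blast
  qed
qed

section \<open>Computations\<close>

lemma ctgt_Cons [simp]: "ctgt (Comp R (t # ts)) = ctgt (Comp (tgt t) ts)"
  by simp

lemma ctgt_append [simp]: "ctgt (Comp R (xs @ ys)) = ctgt (Comp (ctgt (Comp R xs)) ys)"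
  by simp

declare ctgt.simps [simp del]

lemma ctgt_Nil [simp]: "ctgt (Comp R []) = R"
  by (simp add: ctgt.simps)

lemma path_append [simp]:
  "path bar R (xs @ ys) \<longleftrightarrow> path bar R xs \<and> path bar (ctgt (Comp R xs)) ys"
  by (induction xs arbitrary: R) auto

lemma path_reachable: "reachable R \<Longrightarrow> path bar R xs \<Longrightarrow> reachable (ctgt (Comp R xs))"
  by (induction xs arbitrary: R) (auto simp: is_trans_def)

text \<open>The easy direction of the theorem: both sides of a square end in the same process, and a
  reverse exchanges source and target.\<close>

lemma causal_eq_ends:
  assumes "causal_eq bar v w"
  shows "csrc v = csrc w \<and> ctgt v = ctgt w"
  using assms
proof induction
  case (cat v w v' w')
  then show ?case by (cases v; cases w; cases v'; cases w') (simp add: ccat_def)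
next
  case (swap t u t' u')
  then show ?case by (simp add: concurrent_def)
next
  case (cancel t u)
  then show ?case by (auto simp: is_reverse_def fwd_bwd_pair_def)
qed simp_all

lemma causal_eq_append_right:
  assumes "causal_eq bar (Comp R xs) (Comp R ys)" and "reachable R" and "path bar R xs"
    and "path bar (ctgt (Comp R xs)) zs"
  shows "causal_eq bar (Comp R (xs @ zs)) (Comp R (ys @ zs))"
proof -
  let ?w = "Comp (ctgt (Comp R xs)) zs"
  have "causal_eq bar ?w ?w"
    by (rule causal_eq.refl) (use assms path_reachable in \<open>auto simp: is_comp_def\<close>)
  with assms(1) have "causal_eq bar (ccat (Comp R xs) ?w) (ccat (Comp R ys) ?w)"
    by (rule causal_eq.cat) (simp_all add: causal_eq_ends[OF assms(1)])
  then show ?thesis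
    by (simp add: ccat_def)
qed

lemma causal_eq_append_left:
  assumes "causal_eq bar (Comp (ctgt (Comp R xs)) ys) (Comp (ctgt (Comp R xs)) zs)"
    and "reachable R" and "path bar R xs"
  shows "causal_eq bar (Comp R (xs @ ys)) (Comp R (xs @ zs))"
proof -
  have "causal_eq bar (Comp R xs) (Comp R xs)"
    by (rule causal_eq.refl) (use assms in \<open>auto simp: is_comp_def\<close>)
  from causal_eq.cat[OF this assms(1)] show ?thesis
    by (simp add: ccat_def)
qed

lemma causal_eq_Cons:
  assumes "causal_eq bar (Comp (tgt t) ys) (Comp (tgt t) zs)" and "is_trans bar t"
  shows "causal_eq bar (Comp (src t) (t # ys)) (Comp (src t) (t # zs))"
  using causal_eq_append_left[of bar "src t" "[t]" ys zs] assms by (simp add: is_trans_def)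

lemma causal_eq_cancel:
  assumes "is_trans bar t" and "is_trans bar u" and "is_reverse bar t u" and "path bar (src t) ys"
  shows "causal_eq bar (Comp (src t) (t # u # ys)) (Comp (src t) ys)"
proof -
  have "src u = tgt t" "tgt u = src t"
    using assms(3) by (auto simp: is_reverse_def fwd_bwd_pair_def)
  with causal_eq_append_right[OF causal_eq.cancel[OF assms(1-3)], of ys] assms show ?thesis
    by (simp add: is_trans_def)
qed

lemma exists_reverse:
  assumes "is_trans bar t"
  shows "\<exists>u. is_trans bar u \<and> is_reverse bar t u \<and> is_reverse bar u t \<and>
    src u = tgt t \<and> tgt u = src t \<and> dir u \<noteq> dir t"
proof (cases "dir t")
  case Forward
  with assms have "fwd (src t) (lab t) (tgt t)"
    by (simp add: is_trans_def)
  then obtain m where "bwd bar (tgt t) (act_of t, m, key_of t) (src t)"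
    "corr_rate bar (rate_of t) m"
    using fwd_imp_bwd by blast
  with Forward assms show ?thesis
    by (intro exI[of _ "Trans (tgt t) Backward (act_of t, m, key_of t) (src t)"])
      (simp add: is_trans_def is_reverse_def fwd_bwd_pair_def)
next
  case Backward
  with assms have "bwd bar (src t) (lab t) (tgt t)"
    by (simp add: is_trans_def)
  then obtain m where "fwd (tgt t) (act_of t, m, key_of t) (src t)"
    "corr_rate bar m (rate_of t)"
    using bwd_imp_fwd by blast
  with Backward assms show ?thesis
    by (intro exI[of _ "Trans (tgt t) Forward (act_of t, m, key_of t) (src t)"])
      (simp add: is_trans_def is_reverse_def fwd_bwd_pair_def)
qed

text \<open>Computations modulo causal equivalence form a groupoid: the inverse reverses every step,
  in the opposite order.\<close>

lemma exists_inverse_path: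
  assumes "reachable R" and "path bar R xs"
  shows "\<exists>ys. path bar (ctgt (Comp R xs)) ys \<and> causal_eq bar (Comp R (xs @ ys)) (Comp R [])"
  using assms
proof (induction xs arbitrary: R)
  case Nil
  then show ?case by (intro exI[of _ "[]"]) (auto intro: causal_eq.refl simp: is_comp_def)
next
  case (Cons t ts)
  then have t: "is_trans bar t" "src t = R" "path bar (tgt t) ts" "reachable (tgt t)"
    by (auto simp: is_trans_def)
  obtain ys where ys: "path bar (ctgt (Comp (tgt t) ts)) ys"
    "causal_eq bar (Comp (tgt t) (ts @ ys)) (Comp (tgt t) [])"
    using Cons.IH t by blast
  obtain u where u: "is_trans bar u" "is_reverse bar t u" "src u = tgt t"
    using exists_reverse t(1) by blast
  \<comment> \<open>Equivalence with the empty computation forces \<open>ts @ ys\<close> to be a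
    loop at \<open>tgt t\<close>, so \<open>u\<close> can follow it.\<close>
  have end_ys: "ctgt (Comp (tgt t) (ts @ ys)) = tgt t"
    using causal_eq_ends[OF ys(2)] by simp
  have "causal_eq bar (Comp (tgt t) ((ts @ ys) @ [u])) (Comp (tgt t) ([] @ [u]))"
    by (rule causal_eq_append_right) (use ys t u end_ys in auto)
  from causal_eq_Cons[OF this t(1)]
  have "causal_eq bar (Comp R (t # (ts @ ys) @ [u])) (Comp R [t, u])"
    using t by simp
  moreover have "causal_eq bar (Comp R [t, u]) (Comp R [])"
    using causal_eq_cancel[OF t(1) u(1,2), of "[]"] t by simp
  ultimately have "causal_eq bar (Comp R ((t # ts) @ (ys @ [u]))) (Comp R [])"
    by (simp add: causal_eq.trans)
  moreover have "path bar (ctgt (Comp R (t # ts))) (ys @ [u])"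
    using ys u end_ys by simp
  ultimately show ?case by blast
qed

text \<open>Append an inverse \<open>us\<close> of \<open>zs\<close> to both sides.\<close>

lemma causal_eq_cancel_right:
  assumes "causal_eq bar (Comp R (xs @ zs)) (Comp R (ys @ zs))"
    and "reachable R" and "path bar R xs" and "path bar R ys"
    and "ctgt (Comp R xs) = ctgt (Comp R ys)" and "path bar (ctgt (Comp R xs)) zs"
  shows "causal_eq bar (Comp R xs) (Comp R ys)"
proof -
  let ?Q = "ctgt (Comp R xs)"
  obtain us where us: "path bar (ctgt (Comp ?Q zs)) us"
    "causal_eq bar (Comp ?Q (zs @ us)) (Comp ?Q [])"
    using exists_inverse_path assms path_reachable by blast
  have "causal_eq bar (Comp R (xs @ zs @ us)) (Comp R (ys @ zs @ us))"
    using causal_eq_append_right[OF assms(1), of us] assms us by simp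
  moreover have "causal_eq bar (Comp R (xs @ zs @ us)) (Comp R xs)"
    using causal_eq_append_left[OF us(2)] assms by simp
  moreover have "causal_eq bar (Comp R (ys @ zs @ us)) (Comp R ys)"
    using causal_eq_append_left[of bar R ys "zs @ us" "[]"] us(2) assms by simp
  ultimately show ?thesis
    by (meson causal_eq.sym causal_eq.trans)
qed

section \<open>Backward computations to the origin\<close>

definition to_origin ::
    "(rate \<Rightarrow> rate) \<Rightarrow> ('a, 'k) proc \<Rightarrow> ('a, 'k) trans list \<Rightarrow> bool" where
  "to_origin bar R ts \<longleftrightarrow>
     path bar R ts \<and> (\<forall>t\<in>set ts. dir t = Backward) \<and> std (ctgt (Comp R ts))"

lemma to_origin_Nil [simp]: "to_origin bar R [] \<longleftrightarrow> std R"
  by (simp add: to_origin_def)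

lemma to_origin_Cons [simp]:
  "to_origin bar R (t # ts) \<longleftrightarrow>
     is_trans bar t \<and> src t = R \<and> dir t = Backward \<and> to_origin bar (tgt t) ts"
  by (auto simp: to_origin_def)

text \<open>Prepend the reverse of the last forward step to a list obtained for its source.\<close>

lemma exists_to_origin:
  assumes "reachable R"
  shows "\<exists>ts. to_origin bar R ts"
  using assms
proof (induction rule: reachable_induct)
  case (std P)
  then show ?case by (intro exI[of _ "[]"]) simp
next
  case (step R x R')
  then have "is_trans bar (Trans R Forward x R')"
    by (simp add: is_trans_def reachable_fwd)
  then obtain u where "is_trans bar u" "src u = R'" "tgt u = R" "dir u = Backward"
    using exists_reverse[of bar "Trans R Forward x R'"] by (auto intro: dir.exhaust)
  with step.IH show ?case by (metis to_origin_Cons)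
qed

lemma to_origin_unique:
  assumes "reachable R" and "to_origin bar R ts" and "to_origin bar R us"
  shows "causal_eq bar (Comp R ts) (Comp R us)"
  using assms
proof (induction "card (keys R)" arbitrary: R ts us rule: less_induct)
  case less
  show ?case
  proof (cases "std R")
    case True
    \<comment> \<open>A forward process has no backward transition, so the list cannot
      start.\<close>
    then have "vs = []" if "to_origin bar R vs" for vs
      using that by (cases vs) (auto simp: is_trans_def std_no_bwd)
    then have "ts = []" "us = []"
      using less.prems by blast+
    then show ?thesis
      using less.prems(1) by (simp add: causal_eq.refl is_comp_def)
  next
    case False
    then obtain t ts' u us' where tu: "ts = t # ts'" "us = u # us'"
      using less.prems by (metis list.exhaust to_origin_Nil)
    have t: "is_trans bar t" "src t = R" "dir t = Backward" "to_origin bar (tgt t) ts'"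
      and u: "is_trans bar u" "src u = R" "dir u = Backward" "to_origin bar (tgt u) us'"
      using less.prems tu by auto
    have bt: "bwd bar R (lab t) (tgt t)" "reachable (tgt t)"
      and bu: "bwd bar R (lab u) (tgt u)" "reachable (tgt u)"
      using t u by (auto simp: is_trans_def)
    \<comment> \<open>Induction hypothesis in the form used below: after a common first step
      \<open>s\<close> the number of keys has dropped.\<close>
    have IH: "causal_eq bar (Comp R (s # vs)) (Comp R (s # ws))"
      if "is_trans bar s" "src s = R" "dir s = Backward"
        "to_origin bar (tgt s) vs" "to_origin bar (tgt s) ws" for s vs ws
    proof -
      have "bwd bar R (lab s) (tgt s)" "reachable (tgt s)"
        using that by (auto simp: is_trans_def)
      then have "causal_eq bar (Comp (tgt s) vs) (Comp (tgt s) ws)"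
        using less.hyps bwd_card_keys that by blast
      from causal_eq_Cons[OF this that(1)] that(2) show ?thesis by simp
    qed
    show ?thesis
    proof (cases "key_of t = key_of u")
      case True
      then have "t = u"
        using bwd_determ[OF bt(1) bu(1)] t u by (auto intro: trans.expand)
      then show ?thesis using IH t u tu by simp
    next
      case False
      then obtain S where S: "bwd bar (tgt t) (lab u) S" "bwd bar (tgt u) (lab t) S"
        using bwd_diamond[OF bt(1) bu(1)] by auto
      define t' u' where "t' = Trans (tgt u) Backward (lab t) S"
        and "u' = Trans (tgt t) Backward (lab u) S"
      have S_reach: "reachable S" using reachable_bwd bt(2) S(1) by blast
      then have t': "is_trans bar t'" "is_trans bar u'"
        using S bt bu by (auto simp: t'_def u'_def is_trans_def)
      \<comment> \<open>\<open>vs\<close> prolongs both sides of the square to the origin, which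
        makes each comparable with \<open>ts\<close> or \<open>us\<close> through a common first
        step.\<close>
      obtain vs where vs: "to_origin bar S vs" using exists_to_origin[OF S_reach] by blast
      \<comment> \<open>Each kind of conflict involves a forward transition, and both
        \<open>t\<close> and \<open>u\<close> are backward.\<close>
      have "concurrent t u"
        using t u by (simp add: concurrent_def conflict_def causal_conflict_def choice_conflict_def)
      then have "causal_eq bar (Comp R [t, u']) (Comp R [u, t'])"
        using causal_eq.swap[of bar t u t' u'] t u t' by (simp add: t'_def u'_def)
      then have sq: "causal_eq bar (Comp R (t # u' # vs)) (Comp R (u # t' # vs))"
        using causal_eq_append_right[of bar R "[t, u']" "[u, t']" vs] less.prems(1) t t' vs
        by (simp add: u'_def to_origin_def)
      have "causal_eq bar (Comp R ts) (Comp R (t # u' # vs))"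
        unfolding tu by (rule IH) (use t t' vs in \<open>auto simp: u'_def\<close>)
      moreover have "causal_eq bar (Comp R (u # t' # vs)) (Comp R us)"
        unfolding tu by (rule IH) (use u t' vs in \<open>auto simp: t'_def\<close>)
      ultimately show ?thesis using sq by (meson causal_eq.trans)
    qed
  qed
qed

text \<open>If \<open>t\<close> is backward, \<open>t # us\<close> is itself a backward computation
  to the origin. If \<open>t\<close> is forward with reverse \<open>u\<close>, then
  \<open>u # ts\<close> is one from \<open>tgt t\<close>, hence equivalent to \<open>us\<close>, and
  \<open>t\<close> cancels against \<open>u\<close>.\<close>

lemma causal_eq_step_to_origin:
  assumes "is_trans bar t" and "to_origin bar (src t) ts" and "to_origin bar (tgt t) us"
  shows "causal_eq bar (Comp (src t) (t # us)) (Comp (src t) ts)"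
proof (cases "dir t")
  case Backward
  with assms show ?thesis
    by (intro to_origin_unique) (auto simp: is_trans_def)
next
  case Forward
  obtain u where u: "is_trans bar u" "is_reverse bar t u" "src u = tgt t" "tgt u = src t"
    "dir u = Backward"
    using exists_reverse[OF assms(1)] Forward by (metis dir.exhaust)
  have "causal_eq bar (Comp (tgt t) us) (Comp (tgt t) (u # ts))"
    by (rule to_origin_unique) (use assms u in \<open>auto simp: is_trans_def\<close>)
  then have "causal_eq bar (Comp (src t) (t # us)) (Comp (src t) (t # u # ts))"
    using assms(1) by (rule causal_eq_Cons)
  moreover have "causal_eq bar (Comp (src t) (t # u # ts)) (Comp (src t) ts)"
    by (rule causal_eq_cancel) (use assms u in \<open>auto simp: to_origin_def\<close>)
  ultimately show ?thesis by (rule causal_eq.trans)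
qed

text \<open>The triangles of the single steps are glued along \<open>xs\<close>, with a computation
  to the origin chosen at each process visited.\<close>

lemma causal_eq_path_to_origin:
  assumes "reachable R" and "path bar R xs" and "to_origin bar R ts"
    and "to_origin bar (ctgt (Comp R xs)) us"
  shows "causal_eq bar (Comp R (xs @ us)) (Comp R ts)"
  using assms
proof (induction xs arbitrary: R ts)
  case Nil
  then show ?case by (simp add: to_origin_unique)
next
  case (Cons t xs)
  then have t: "is_trans bar t" "src t = R" "reachable (tgt t)"
    by (auto simp: is_trans_def)
  obtain vs where vs: "to_origin bar (tgt t) vs"
    using exists_to_origin[OF t(3)] by blast
  have "causal_eq bar (Comp (tgt t) (xs @ us)) (Comp (tgt t) vs)"
    using Cons.IH[OF t(3) _ vs] Cons.prems by simp
  from causal_eq_Cons[OF this t(1)]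
  have "causal_eq bar (Comp R (t # xs @ us)) (Comp R (t # vs))"
    using t by simp
  moreover have "causal_eq bar (Comp R (t # vs)) (Comp R ts)"
    using causal_eq_step_to_origin[of bar t ts vs] t vs Cons.prems by simp
  ultimately show ?case by (simp add: causal_eq.trans)
qed

theorem theorem4p10:
  fixes bar :: "rate \<Rightarrow> rate"
    and \<omega>1 \<omega>2 :: "('a::countable, 'k::countable) comp"
  assumes "is_comp bar \<omega>1" and "is_comp bar \<omega>2"
  shows "causal_eq bar \<omega>1 \<omega>2 \<longleftrightarrow> coinitial_comps \<omega>1 \<omega>2 \<and> cofinal_comps \<omega>1 \<omega>2"
proof
  assume "causal_eq bar \<omega>1 \<omega>2"
  then show "coinitial_comps \<omega>1 \<omega>2 \<and> cofinal_comps \<omega>1 \<omega>2"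
    by (simp add: coinitial_comps_def cofinal_comps_def causal_eq_ends)
next
  assume ends: "coinitial_comps \<omega>1 \<omega>2 \<and> cofinal_comps \<omega>1 \<omega>2"
  then obtain R xs ys where w: "\<omega>1 = Comp R xs" "\<omega>2 = Comp R ys"
    by (cases \<omega>1; cases \<omega>2) (auto simp: coinitial_comps_def)
  have R: "reachable R" "path bar R xs" "path bar R ys"
    and eq: "ctgt (Comp R xs) = ctgt (Comp R ys)"
    using assms ends w by (auto simp: is_comp_def cofinal_comps_def)
  obtain ts where ts: "to_origin bar R ts"
    using exists_to_origin[OF R(1)] by blast
  \<comment> \<open>\<open>us\<close> starts at the common target, so it continues both
    \<open>xs\<close> and \<open>ys\<close>; each prolonged computation is equivalent to
    \<open>ts\<close>, and \<open>us\<close> is cancelled at the end.\<close>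
  obtain us where us: "to_origin bar (ctgt (Comp R xs)) us"
    using exists_to_origin[OF path_reachable[OF R(1,2)]] by blast
  have "causal_eq bar (Comp R (xs @ us)) (Comp R ts)"
    using causal_eq_path_to_origin[OF R(1,2) ts us] .
  moreover have "causal_eq bar (Comp R (ys @ us)) (Comp R ts)"
    using causal_eq_path_to_origin[OF R(1,3) ts] us eq by simp
  ultimately have "causal_eq bar (Comp R (xs @ us)) (Comp R (ys @ us))"
    by (meson causal_eq.sym causal_eq.trans)
  from causal_eq_cancel_right[OF this R eq] us show "causal_eq bar \<omega>1 \<omega>2"
    by (simp add: w to_origin_def)
qed

end
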